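(* Let $(\Omega,\Sigma,\mu)$ be a probability space and let $f\in L_\infty[\mu]$ be real-valued. Write $E[g]=\int_\Omega g\,\mathrm{d}\mu$ and let $S_f(\gamma)$ denote the canonical entropy of $f$ at inverse temperature $\gamma$. Then for any $\beta>0$ $$\ln E\bigl[\mathrm{e}^{\beta(f-E[f])}\bigr]=\beta\int_0^\beta\frac{S_f(\gamma)}{\gamma^2}\,\mathrm{d}\gamma ,$$ and, for every $t\ge 0$, $$\Pr\{f-E[f]>t\}\le\exp\left(\beta\int_0^\beta\frac{S_f(\gamma)}{\gamma^2}\,\mathrm{d}\gamma-\beta t\right).$$
   Context: For $\beta\in\mathbb{R}$: the partition function is $Z_{\beta f}=E[\mathrm{e}^{\beta f}]$; the thermal expectation of $g\in L_\infty[\mu]$ is $E_{\beta f}[g]=E[g\,\mathrm{e}^{\beta f}]/E[\mathrm{e}^{\beta f}]$; the canonical entropy is $S_f(\beta)=\beta E_{\beta f}[f]-\ln Z_{\beta f}$. $\Pr$ denotes probability under $\mu$. *)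

theory Defs
  imports "HOL-Probability.Probability"
begin

definition L_infinity :: "'a measure \<Rightarrow> ('a \<Rightarrow> real) set" where
  "L_infinity M = {f \<in> borel_measurable M. \<exists>C. AE x in M. \<bar>f x\<bar> \<le> C}"

text \<open>The second argument of \<open>partition_function\<close> is the exponent, written \<open>\<beta>f\<close> in the
  usual notation; the inverse temperature is not a separate argument.  Likewise for
  \<open>thermal_expectation\<close>.\<close>

definition partition_function :: "'a measure \<Rightarrow> ('a \<Rightarrow> real) \<Rightarrow> real" where
  "partition_function M h = (\<integral>x. exp (h x) \<partial>M)"

definition thermal_expectation :: "'a measure \<Rightarrow> ('a \<Rightarrow> real) \<Rightarrow> ('a \<Rightarrow> real) \<Rightarrow> real" where
  "thermal_expectation M h g = (\<integral>x. g x * exp (h x) \<partial>M) / (\<integral>x. exp (h x) \<partial>M)"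

definition canonical_entropy :: "'a measure \<Rightarrow> ('a \<Rightarrow> real) \<Rightarrow> real \<Rightarrow> real" where
  "canonical_entropy M f \<beta> =
     \<beta> * thermal_expectation M (\<lambda>x. \<beta> * f x) f - ln (partition_function M (\<lambda>x. \<beta> * f x))"

end

theory Submission
  imports Defs
begin

text \<open>
  Put \<open>L(\<gamma>) = ln E[exp(\<gamma> f)] / \<gamma>\<close>. Its derivative is \<open>S\<^sub>f(\<gamma>) / \<gamma>\<^sup>2\<close>, and \<open>L(\<gamma>)\<close> tends to
  \<open>E[f]\<close> as \<open>\<gamma>\<close> decreases to \<open>0\<close>, so the fundamental theorem of calculus gives the identity.
  Integrability up to the endpoint \<open>0\<close> comes for free, because the entropy is nonnegative.
  The tail bound is then Chernoff's inequality.
\<close>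

section \<open>Differentiation under the integral sign\<close>

lemma abs_exp_minus_one_le:
  fixes u :: real
  shows "\<bar>exp u - 1\<bar> \<le> \<bar>u\<bar> * exp \<bar>u\<bar>"
proof (cases "u \<ge> 0")
  case True
  \<comment> \<open>This is \<open>1 - u \<le> exp (- u)\<close> scaled by \<open>exp u\<close>; the
    right side collapses to 1.\<close>
  have "exp u * (1 - u) \<le> exp u * exp (- u)"
    using exp_ge_add_one_self[of "- u"] by (intro mult_left_mono) auto
  then have "exp u - 1 \<le> u * exp u"
    by (simp add: algebra_simps flip: exp_add)
  with True show ?thesis by simp
next
  case False
  have "\<bar>exp u - 1\<bar> \<le> \<bar>u\<bar>"
    using False exp_ge_add_one_self[of u] exp_le_one_iff[of u] by linarith
  also have "\<dots> \<le> \<bar>u\<bar> * exp \<bar>u\<bar>"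
    by (simp add: mult_le_cancel_left1)
  finally show ?thesis .
qed

text \<open>The bound does not depend on \<open>y\<close> and increases with
  \<open>\<bar>d\<bar>\<close>, so one constant dominates the difference quotients for all steps
  \<open>d\<close> of bounded size. Factoring out \<open>exp (\<gamma> * y)\<close> reduces it to
  the estimate for \<open>exp u - 1\<close> at \<open>u = d * y\<close>, whose factor
  \<open>\<bar>d\<bar>\<close> cancels the denominator.\<close>

lemma abs_exp_diff_quotient_le:
  fixes \<gamma> y d B :: real
  assumes "d \<noteq> 0" "\<bar>y\<bar> \<le> B"
  shows "\<bar>(exp ((\<gamma> + d) * y) - exp (\<gamma> * y)) / d\<bar> \<le> B * exp ((\<bar>\<gamma>\<bar> + \<bar>d\<bar>) * B)"
proof -
  have B: "0 \<le> B" using assms by linarith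
  have "(exp ((\<gamma> + d) * y) - exp (\<gamma> * y)) / d = exp (\<gamma> * y) * (exp (d * y) - 1) / d"
    by (simp add: exp_add algebra_simps)
  then have "\<bar>(exp ((\<gamma> + d) * y) - exp (\<gamma> * y)) / d\<bar> = exp (\<gamma> * y) * \<bar>exp (d * y) - 1\<bar> / \<bar>d\<bar>"
    by (simp only: abs_mult abs_divide abs_exp_cancel)
  also have "\<dots> \<le> exp (\<gamma> * y) * (\<bar>d * y\<bar> * exp \<bar>d * y\<bar>) / \<bar>d\<bar>"
    by (intro divide_right_mono mult_left_mono abs_exp_minus_one_le) auto
  also have "\<dots> = \<bar>y\<bar> * exp (\<gamma> * y + \<bar>d\<bar> * \<bar>y\<bar>)"
    using assms by (simp add: abs_mult exp_add)
  also have "\<dots> \<le> B * exp ((\<bar>\<gamma>\<bar> + \<bar>d\<bar>) * B)"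
  proof (intro mult_mono)
    have "\<gamma> * y \<le> \<bar>\<gamma>\<bar> * \<bar>y\<bar>"
      by (metis abs_ge_self abs_mult)
    moreover have "(\<bar>\<gamma>\<bar> + \<bar>d\<bar>) * \<bar>y\<bar> \<le> (\<bar>\<gamma>\<bar> + \<bar>d\<bar>) * B"
      using assms by (intro mult_left_mono) auto
    ultimately show "exp (\<gamma> * y + \<bar>d\<bar> * \<bar>y\<bar>) \<le> exp ((\<bar>\<gamma>\<bar> + \<bar>d\<bar>) * B)"
      by (simp add: algebra_simps)
  qed (use assms B in auto)
  finally show ?thesis .
qed

lemma (in finite_measure) integrable_mult_exp_of_bounded:
  fixes f h :: "'a \<Rightarrow> real"
  assumes [measurable]: "f \<in> borel_measurable M" "h \<in> borel_measurable M"
    and f: "AE x in M. \<bar>f x\<bar> \<le> B" and h: "AE x in M. \<bar>h x\<bar> \<le> C"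
  shows "integrable M (\<lambda>x. h x * exp (\<gamma> * f x))"
proof (rule integrable_const_bound[where B = "C * exp (\<bar>\<gamma>\<bar> * B)"])
  show "AE x in M. norm (h x * exp (\<gamma> * f x)) \<le> C * exp (\<bar>\<gamma>\<bar> * B)"
    using f h
  proof eventually_elim
    case (elim x)
    have "\<gamma> * f x \<le> \<bar>\<gamma>\<bar> * \<bar>f x\<bar>"
      by (metis abs_ge_self abs_mult)
    also have "\<dots> \<le> \<bar>\<gamma>\<bar> * B"
      using elim by (intro mult_left_mono) auto
    finally show ?case
      using elim by (auto simp: abs_mult intro!: mult_mono)
  qed
qed measurable

text \<open>Dominated convergence applied to the difference quotients along an arbitrary null
  sequence of steps. The weight \<open>h\<close> serves two later uses: \<open>h = 1\<close>
  differentiates the partition function, and \<open>h = f\<close> gives continuity of the numerator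
  of the thermal expectation.\<close>

lemma (in finite_measure) has_real_derivative_integral_mult_exp:
  fixes f h :: "'a \<Rightarrow> real"
  assumes [measurable]: "f \<in> borel_measurable M" "h \<in> borel_measurable M"
    and f: "AE x in M. \<bar>f x\<bar> \<le> B" and h: "AE x in M. \<bar>h x\<bar> \<le> C"
  shows "((\<lambda>\<gamma>. \<integral>x. h x * exp (\<gamma> * f x) \<partial>M) has_real_derivative
           (\<integral>x. h x * (f x * exp (\<gamma> * f x)) \<partial>M)) (at \<gamma>)"
  unfolding DERIV_def tendsto_at_iff_sequentially
proof (intro allI impI)
  fix X :: "nat \<Rightarrow> real"
  assume X: "\<forall>i. X i \<in> UNIV - {0}" and X0: "X \<longlonglongrightarrow> 0"
  \<comment> \<open>A convergent sequence is bounded, and \<open>K\<close> makes the dominating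
    constant independent of \<open>n\<close>.\<close>
  obtain K where K: "\<And>n. \<bar>X n\<bar> \<le> K"
    using convergent_imp_Bseq[OF convergentI[OF X0]] by (auto simp: Bseq_def)
  have "(\<lambda>n. \<integral>x. h x * ((exp ((\<gamma> + X n) * f x) - exp (\<gamma> * f x)) / X n) \<partial>M)
          \<longlonglongrightarrow> (\<integral>x. h x * (f x * exp (\<gamma> * f x)) \<partial>M)"
  proof (rule integral_dominated_convergence[where w = "\<lambda>_. C * (B * exp ((\<bar>\<gamma>\<bar> + K) * B))"])
    show "AE x in M. (\<lambda>n. h x * ((exp ((\<gamma> + X n) * f x) - exp (\<gamma> * f x)) / X n))
            \<longlonglongrightarrow> h x * (f x * exp (\<gamma> * f x))"
    proof (intro AE_I2 tendsto_mult tendsto_const)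
      fix x
      have "((\<lambda>s. exp (s * f x)) has_real_derivative f x * exp (\<gamma> * f x)) (at \<gamma>)"
        by (auto intro!: derivative_eq_intros)
      then show "(\<lambda>n. (exp ((\<gamma> + X n) * f x) - exp (\<gamma> * f x)) / X n)
                   \<longlonglongrightarrow> f x * exp (\<gamma> * f x)"
        using X X0 unfolding DERIV_def tendsto_at_iff_sequentially comp_def by blast
    qed
    show "AE x in M. norm (h x * ((exp ((\<gamma> + X n) * f x) - exp (\<gamma> * f x)) / X n))
            \<le> C * (B * exp ((\<bar>\<gamma>\<bar> + K) * B))" for n
      using f h
    proof eventually_elim
      case (elim x)
      have "\<bar>(exp ((\<gamma> + X n) * f x) - exp (\<gamma> * f x)) / X n\<bar>
              \<le> B * exp ((\<bar>\<gamma>\<bar> + \<bar>X n\<bar>) * B)"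
        using X elim by (intro abs_exp_diff_quotient_le) auto
      also have "\<dots> \<le> B * exp ((\<bar>\<gamma>\<bar> + K) * B)"
        using K[of n] elim by (intro mult_left_mono) (auto intro!: mult_right_mono)
      finally show ?case
        using elim unfolding real_norm_def abs_mult[of "h x"] by (intro mult_mono) auto
    qed
  qed auto
  moreover have "(\<integral>x. h x * ((exp ((\<gamma> + X n) * f x) - exp (\<gamma> * f x)) / X n) \<partial>M) =
      ((\<integral>x. h x * exp ((\<gamma> + X n) * f x) \<partial>M) - (\<integral>x. h x * exp (\<gamma> * f x) \<partial>M)) / X n" for n
    using integrable_mult_exp_of_bounded[OF assms]
    by (simp add: diff_divide_distrib right_diff_distrib)
  ultimately show "((\<lambda>d. ((\<integral>x. h x * exp ((\<gamma> + d) * f x) \<partial>M) -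
      (\<integral>x. h x * exp (\<gamma> * f x) \<partial>M)) / d) \<circ> X)
      \<longlonglongrightarrow> (\<integral>x. h x * (f x * exp (\<gamma> * f x)) \<partial>M)"
    by (simp only: comp_def)
qed

section \<open>Partition function and canonical entropy\<close>

locale bounded_random_variable = prob_space +
  fixes f :: "'a \<Rightarrow> real" and B :: real
  assumes measurable [measurable]: "f \<in> borel_measurable M"
    and bounded: "AE x in M. \<bar>f x\<bar> \<le> B"
begin

abbreviation Z :: "real \<Rightarrow> real" where
  "Z \<gamma> \<equiv> partition_function M (\<lambda>x. \<gamma> * f x)"

lemma integrable_exp: "integrable M (\<lambda>x. exp (\<gamma> * f x))"
  using integrable_mult_exp_of_bounded[OF measurable _ bounded, of "\<lambda>_. 1" 1 \<gamma>] by simp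

lemma integrable_mult_exp: "integrable M (\<lambda>x. f x * exp (\<gamma> * f x))"
  by (rule integrable_mult_exp_of_bounded[OF measurable measurable bounded bounded])

lemma Z_pos: "Z \<gamma> > 0"
  unfolding partition_function_def
  by (rule expectation_greater[OF integrable_exp]) simp

text \<open>The exponent has the form to which simplification brings \<open>0 * f x\<close>; this
  evaluates the partition function at inverse temperature 0.\<close>

lemma partition_function_0: "partition_function M (\<lambda>_. 0) = 1"
  by (simp add: partition_function_def prob_space)

lemma has_real_derivative_Z:
  "(Z has_real_derivative (\<integral>x. f x * exp (\<gamma> * f x) \<partial>M)) (at \<gamma>)"
  using has_real_derivative_integral_mult_exp[OF measurable _ bounded, of "\<lambda>_. 1" 1 \<gamma>]
  by (simp add: partition_function_def[abs_def])

lemma has_real_derivative_ln_Z: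
  "((\<lambda>\<gamma>. ln (Z \<gamma>)) has_real_derivative thermal_expectation M (\<lambda>x. \<gamma> * f x) f) (at \<gamma>)"
  using has_real_derivative_Z[of \<gamma>] Z_pos[of \<gamma>]
  by (auto intro!: derivative_eq_intros
      simp: thermal_expectation_def partition_function_def divide_simps)

text \<open>Numerator and denominator are both differentiable in \<open>\<gamma>\<close>, and the
  denominator is positive. Continuity of the entropy follows, which the fundamental theorem of
  calculus asks of its integrand.\<close>

lemma isCont_thermal_expectation:
  "isCont (\<lambda>\<gamma>. thermal_expectation M (\<lambda>x. \<gamma> * f x) f) \<gamma>"
proof -
  have "isCont (\<lambda>\<gamma>. \<integral>x. f x * exp (\<gamma> * f x) \<partial>M) \<gamma>"
    using has_real_derivative_integral_mult_exp[OF measurable measurable bounded bounded]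
    by (rule DERIV_isCont)
  moreover have "isCont Z \<gamma>"
    using has_real_derivative_Z by (rule DERIV_isCont)
  ultimately show ?thesis
    using Z_pos[of \<gamma>] unfolding thermal_expectation_def partition_function_def[symmetric]
    by (intro continuous_intros) auto
qed

lemma isCont_canonical_entropy: "isCont (canonical_entropy M f) \<gamma>"
proof -
  have "isCont (\<lambda>\<gamma>. ln (Z \<gamma>)) \<gamma>"
    using has_real_derivative_ln_Z by (rule DERIV_isCont)
  then show ?thesis
    unfolding canonical_entropy_def[abs_def]
    by (intro isCont_diff isCont_mult continuous_ident isCont_thermal_expectation)
qed

text \<open>Gibbs' inequality: integrate \<open>p * ln p \<ge> p * ln z + p - z\<close> with \<open>p = exp (\<gamma> * f x)\<close> and
  \<open>z = Z \<gamma>\<close>.\<close>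
lemma canonical_entropy_nonneg: "canonical_entropy M f \<gamma> \<ge> 0"
proof -
  let ?N = "\<integral>x. f x * exp (\<gamma> * f x) \<partial>M"
  note int = integrable_exp[of \<gamma>] integrable_mult_exp[of \<gamma>]
  have "(\<integral>x. exp (\<gamma> * f x) * ln (Z \<gamma>) + exp (\<gamma> * f x) - Z \<gamma> \<partial>M)
          \<le> (\<integral>x. \<gamma> * (f x * exp (\<gamma> * f x)) \<partial>M)"
  proof (rule integral_mono)
    fix x
    let ?p = "exp (\<gamma> * f x)"
    \<comment> \<open>The pointwise inequality is \<open>ln s \<le> s - 1\<close> at
      \<open>s = Z \<gamma> / ?p\<close>, multiplied by \<open>?p\<close>.\<close>
    have "ln (Z \<gamma> / ?p) \<le> Z \<gamma> / ?p - 1"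
      using Z_pos[of \<gamma>] by (intro ln_le_minus_one) auto
    then have "?p * (ln (Z \<gamma>) - \<gamma> * f x) \<le> ?p * (Z \<gamma> / ?p - 1)"
      using Z_pos[of \<gamma>] by (intro mult_left_mono) (auto simp: ln_div)
    then show "?p * ln (Z \<gamma>) + ?p - Z \<gamma> \<le> \<gamma> * (f x * ?p)"
      by (simp add: algebra_simps)
  qed (use int in auto)
  \<comment> \<open>The total mass is 1, so \<open>exp (\<gamma> * f x)\<close> and the constant
    \<open>Z \<gamma>\<close> have the same integral and cancel.\<close>
  then have "Z \<gamma> * ln (Z \<gamma>) \<le> \<gamma> * ?N"
    using int by (simp add: partition_function_def prob_space)
  then have "ln (Z \<gamma>) \<le> \<gamma> * ?N / Z \<gamma>"
    using Z_pos[of \<gamma>] by (simp add: pos_le_divide_eq mult.commute)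
  then show ?thesis
    by (simp add: canonical_entropy_def thermal_expectation_def partition_function_def)
qed

section \<open>The entropy integral\<close>

lemma has_real_derivative_ln_Z_div:
  assumes "\<gamma> \<noteq> 0"
  shows "((\<lambda>\<gamma>. ln (Z \<gamma>) / \<gamma>) has_real_derivative canonical_entropy M f \<gamma> / \<gamma>\<^sup>2) (at \<gamma>)"
  \<comment> \<open>The numerator produced by the quotient rule, \<gamma> times the thermal
    expectation minus \<open>ln (Z \<gamma>)\<close>, is the canonical entropy.\<close>
  using DERIV_divide[OF has_real_derivative_ln_Z DERIV_ident assms]
  by (simp add: canonical_entropy_def power2_eq_square mult.commute)

text \<open>Since \<open>ln (Z 0) = 0\<close>, the quotient is the difference quotient of
  \<open>ln (Z \<gamma>)\<close> at 0. Its limit is the derivative there, the thermal expectation at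
  inverse temperature 0, which is the plain mean.\<close>

lemma tendsto_ln_Z_div_0: "((\<lambda>\<gamma>. ln (Z \<gamma>) / \<gamma>) \<longlongrightarrow> expectation f) (at 0)"
  using has_real_derivative_ln_Z[of 0]
  by (simp add: DERIV_def thermal_expectation_def partition_function_0 prob_space)

lemma entropy_integral:
  assumes "\<beta> > 0"
  shows "set_integrable lborel (einterval 0 (ereal \<beta>)) (\<lambda>\<gamma>. canonical_entropy M f \<gamma> / \<gamma>\<^sup>2)"
    and "(LBINT \<gamma>=0..ereal \<beta>. canonical_entropy M f \<gamma> / \<gamma>\<^sup>2) = ln (Z \<beta>) / \<beta> - expectation f"
proof -
  \<comment> \<open>The fundamental theorem is used on the open interval and takes one-sided limits
    of the antiderivative at extended real endpoints. The values at 0, where division by zero yields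
    0, therefore do not enter.\<close>
  have left: "(((\<lambda>\<gamma>. ln (Z \<gamma>) / \<gamma>) \<circ> real_of_ereal) \<longlongrightarrow> expectation f) (at_right 0)"
    using tendsto_ln_Z_div_0 unfolding zero_ereal_def ereal_tendsto_simps
    by (rule filterlim_mono) (auto simp: at_le)
  have "isCont (\<lambda>\<gamma>. ln (Z \<gamma>) / \<gamma>) \<beta>"
    using assms by (intro DERIV_isCont[OF has_real_derivative_ln_Z_div]) auto
  then have right: "(((\<lambda>\<gamma>. ln (Z \<gamma>) / \<gamma>) \<circ> real_of_ereal) \<longlongrightarrow> ln (Z \<beta>) / \<beta>) (at_left (ereal \<beta>))"
    unfolding ereal_tendsto_simps isCont_def by (rule filterlim_mono) (auto simp: at_le)
  have deriv: "((\<lambda>\<gamma>. ln (Z \<gamma>) / \<gamma>) has_real_derivative canonical_entropy M f \<gamma> / \<gamma>\<^sup>2) (at \<gamma>)"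
    and cont: "isCont (\<lambda>\<gamma>. canonical_entropy M f \<gamma> / \<gamma>\<^sup>2) \<gamma>" if "0 < ereal \<gamma>" for \<gamma>
    using that by (auto intro!: has_real_derivative_ln_Z_div continuous_intros isCont_canonical_entropy)
  have nonneg: "AE \<gamma> in lborel. 0 < ereal \<gamma> \<longrightarrow> ereal \<gamma> < ereal \<beta> \<longrightarrow>
      0 \<le> canonical_entropy M f \<gamma> / \<gamma>\<^sup>2"
    using canonical_entropy_nonneg by simp
  have "0 < ereal \<beta>" using assms by simp
  note FTC = interval_integral_FTC_nonneg[OF this deriv cont nonneg left right]
  show "set_integrable lborel (einterval 0 (ereal \<beta>)) (\<lambda>\<gamma>. canonical_entropy M f \<gamma> / \<gamma>\<^sup>2)"
    and "(LBINT \<gamma>=0..ereal \<beta>. canonical_entropy M f \<gamma> / \<gamma>\<^sup>2) = ln (Z \<beta>) / \<beta> - expectation f"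
    using FTC by blast+
qed

section \<open>The centered moment generating function and the tail bound\<close>

lemma centered_exp_eq: "exp (\<beta> * (f x - c)) = exp (- \<beta> * c) * exp (\<beta> * f x)"
  by (simp add: algebra_simps flip: exp_add)

text \<open>The right side is kept as a single exponential: \<open>ln\<close> then undoes it for the
  identity, and in the tail bound the Chernoff factor is absorbed by adding exponents.\<close>

lemma expectation_centered_exp:
  "expectation (\<lambda>x. exp (\<beta> * (f x - expectation f))) = exp (ln (Z \<beta>) - \<beta> * expectation f)"
  using Z_pos[of \<beta>] unfolding centered_exp_eq
  by (simp add: partition_function_def exp_diff exp_minus field_simps)

lemma tail_bound:
  assumes "\<beta> > 0"
  shows "prob {x \<in> space M. f x - expectation f > t}
           \<le> exp (ln (Z \<beta>) - \<beta> * expectation f - \<beta> * t)"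
proof -
  \<comment> \<open>Chernoff's inequality is applied to the larger event with a non-strict
    inequality.\<close>
  have "prob {x \<in> space M. f x - expectation f > t}
          \<le> prob {x \<in> space M. f x - expectation f \<ge> t}"
    by (intro finite_measure_mono) auto
  also have "\<dots> \<le> exp (- \<beta> * t) * (\<integral>x\<in>space M. exp (\<beta> * (f x - expectation f)) \<partial>M)"
  proof (rule Chernoff_ineq_ge)
    have "integrable M (\<lambda>x. exp (\<beta> * (f x - expectation f)))"
      unfolding centered_exp_eq using integrable_exp by auto
    then show "set_integrable M (space M) (\<lambda>x. exp (\<beta> * (f x - expectation f)))"
      unfolding set_integrable_def by (rule integrable_mult_indicator[OF sets.top])
  qed (use assms in auto)
  also have "(\<integral>x\<in>space M. exp (\<beta> * (f x - expectation f)) \<partial>M) =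
      exp (ln (Z \<beta>) - \<beta> * expectation f)"
    unfolding expectation_centered_exp[symmetric]
    by (rule set_integral_space) (unfold centered_exp_eq, use integrable_exp in auto)
  finally show ?thesis
    by (simp add: algebra_simps flip: exp_add)
qed

end

theorem theorem1:
  fixes M :: "'a measure" and f :: "'a \<Rightarrow> real" and \<beta> :: real
  assumes "prob_space M"
    and "f \<in> L_infinity M"
    and "\<beta> > 0"
  shows "interval_lebesgue_integrable lborel 0 (ereal \<beta>)
           (\<lambda>\<gamma>. canonical_entropy M f \<gamma> / \<gamma>\<^sup>2)
       \<and> ln (\<integral>x. exp (\<beta> * (f x - (\<integral>y. f y \<partial>M))) \<partial>M)
           = \<beta> * (LBINT \<gamma>=0..ereal \<beta>. canonical_entropy M f \<gamma> / \<gamma>\<^sup>2)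
       \<and> (\<forall>t\<ge>0. measure M {x \<in> space M. f x - (\<integral>y. f y \<partial>M) > t}
           \<le> exp (\<beta> * (LBINT \<gamma>=0..ereal \<beta>. canonical_entropy M f \<gamma> / \<gamma>\<^sup>2) - \<beta> * t))"
proof -
  \<comment> \<open>Membership in \<open>L_infinity\<close> asserts only that some essential bound
    exists; fixing one supplies the locale parameter \<open>B\<close>.\<close>
  obtain B where "f \<in> borel_measurable M" "AE x in M. \<bar>f x\<bar> \<le> B"
    using assms(2) by (auto simp: L_infinity_def)
  then interpret bounded_random_variable M f B
    using assms(1) by (simp add: bounded_random_variable_def bounded_random_variable_axioms_def)
  \<comment> \<open>Scaled by \<beta>, the entropy integral becomes the exponent shared by the
    centered expectation and the tail bound, so both claims follow by substitution.\<close>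
  have "\<beta> * (LBINT \<gamma>=0..ereal \<beta>. canonical_entropy M f \<gamma> / \<gamma>\<^sup>2) =
      ln (Z \<beta>) - \<beta> * expectation f"
    using assms(3) by (simp add: entropy_integral(2) right_diff_distrib)
  then show ?thesis
    using assms(3) entropy_integral(1)[OF assms(3)] tail_bound[OF assms(3)]
    by (simp add: interval_lebesgue_integrable_def expectation_centered_exp)
qed

end
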